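(* Let $a_n = f_{132}(\mathrm{Av}_n(123))$, $b_n = f_{231}(\mathrm{Av}_n(123))$, and $d_n = f_{321}(\mathrm{Av}_n(123))$. Then we have that $$ a_n = \frac{n+2}{4} \binom{2n}{n} - 3 \cdot 2^{2n-3}, $$ $$ b_n = (2n-1) \binom{2n-3}{n-2} - (2n+1)\binom{2n-1}{n-1} + (n+4) \cdot 2^{2n-3},$$ $$ d_n = \frac{1}{6} \binom{2n+5}{n+1} \binom{n+4}{2} - \frac{5}{3} \binom{2n+3}{n} \binom{n+3}{2} + \frac{17}{3} \binom{2n+1}{n-1} \binom{n+2}{2} - 6\binom{2n-1}{n-2} \binom{n+1}{2} - (n+1) \cdot 4^{n-1}.$$
   Context: Permutations are written in one-line notation. For $p = p_1\cdots p_n \in S_n$ and $q = q_1 \cdots q_k\in S_k$, an occurrence of $q$ in $p$ (as a pattern) is a choice of indices $1 \le i_1 < \dots < i_k \le n$ such that $p_{i_1},\dots,p_{i_k}$ are in the same relative order as $q_1,\dots,q_k$ (i.e. $p_{i_s}<p_{i_t}$ iff $q_s<q_t$). $f_q(p)$ denotes the number of occurrences of $q$ in $p$, and $p$ avoids $q$ if $f_q(p)=0$. $\mathrm{Av}_n(r)$ is the set of permutations in $S_n$ avoiding $r$. For a finite set $\mathcal C$ of permutations, $f_q(\mathcal C)=\sum_{p\in\mathcal C} f_q(p)$.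
   Formalization: The formulas for a_n and d_n are stated for n ≥ 1 and that for b_n for n ≥ 2: at n = 0 the a_n formula gives 1/8 instead of 0, and at n = 1 the b_n formula contains binom(-1,-1) and gives ±1/2 instead of 0 under the usual values; binom(1,-1) in d_1 is read as 0. *)

theory Defs
  imports Complex_Main "HOL-Combinatorics.Multiset_Permutations"
begin

(* One-line notation: an element of S_n is a list enumerating {1..n} without repetition. *)
definition perms :: "nat \<Rightarrow> nat list set" where
  "perms n = permutations_of_set {1..n}"

(* An occurrence is recorded as the increasing list of its (0-based) positions. *)
definition occurrences :: "nat list \<Rightarrow> nat list \<Rightarrow> nat list set" where
  "occurrences q p = {idx. length idx = length q \<and> sorted_wrt (<) idx \<and> set idx \<subseteq> {..<length p} \<and>
     (\<forall>s<length q. \<forall>t<length q. p ! (idx ! s) < p ! (idx ! t) \<longleftrightarrow> q ! s < q ! t)}"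

definition num_occ :: "nat list \<Rightarrow> nat list \<Rightarrow> nat" where
  "num_occ q p = card (occurrences q p)"

definition avoids :: "nat list \<Rightarrow> nat list \<Rightarrow> bool" where
  "avoids p q \<longleftrightarrow> num_occ q p = 0"

definition Av :: "nat \<Rightarrow> nat list \<Rightarrow> nat list set" where
  "Av n r = {p \<in> perms n. avoids p r}"

definition total_occ :: "nat list \<Rightarrow> nat list set \<Rightarrow> nat" where
  "total_occ q C = (\<Sum>p\<in>C. num_occ q p)"

(* Neither card nor sum above ever falls back to its default value for infinite sets. *)
lemma finite_occurrences: "finite (occurrences q p)"
proof (rule finite_subset)
  show "occurrences q p \<subseteq> {idx. set idx \<subseteq> {..<length p} \<and> length idx = length q}"
    by (auto simp: occurrences_def)
  show "finite {idx. set idx \<subseteq> {..<length p} \<and> length idx = length q}"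
    by (rule finite_lists_length_eq) simp
qed

lemma finite_Av: "finite (Av n r)"
  by (simp add: Av_def perms_def)

(* Binomial coefficient with the convention that it vanishes for a negative lower index;
   truncated subtraction on nat would turn such a coefficient into 1. *)
definition zchoose :: "nat \<Rightarrow> int \<Rightarrow> nat" (infix "zchoose" 64) where
  "m zchoose k = (if k < 0 then 0 else m choose nat k)"

end

theory Submission
  imports Defs
begin

text \<open>Call \<open>p\<close> of type \<open>(n, i)\<close> if it avoids 123, has length \<open>n\<close>, and its \<open>i\<close> largest entries form a
decreasing sequence. Prepending an entry with exactly \<open>j\<close> larger entries to an avoider \<open>p\<close> keeps 123
avoided iff \<open>p\<close> has type \<open>(n, j)\<close>; it then creates \<open>j\<close> new occurrences of 12 and \<open>j choose 2\<close> new
occurrences of 132. This gives a recurrence of ballot type for the total number of occurrences of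
12 and 132 over all permutations of type \<open>(n, i)\<close>, solved by binomial coefficients and a partial
sum of a row of Pascal's triangle, which becomes a power of 4 at \<open>i = 0\<close>.

The other patterns follow by linear algebra. Reverse-complementation exchanges 132 with 213 and 231
with 312. Counting the pairs of type 12 inside all triples expresses \<open>n - 2\<close> times the number of
occurrences of 12 through 123, 132, 213, 231 and 312, and the six patterns of length 3 together
occur \<open>n choose 3\<close> times.\<close>

section \<open>Sums over subsequences\<close>

text \<open>Recursion on the list replaces sets of position lists, so that induction can follow the
  prepending of an entry. Summing a general \<open>f\<close> instead of counting lets several
  patterns be combined linearly.\<close>

fun subseq_sum :: "('a list \<Rightarrow> nat) \<Rightarrow> nat \<Rightarrow> 'a list \<Rightarrow> nat" where
  "subseq_sum f 0 p = f []"
| "subseq_sum f (Suc k) [] = 0"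
| "subseq_sum f (Suc k) (x # p) = subseq_sum (\<lambda>l. f (x # l)) k p + subseq_sum f (Suc k) p"

text \<open>A position list for \<open>x # p\<close> either starts with 0 or is the
  \<open>Suc\<close>-shift of one for \<open>p\<close>. The predicate is arbitrary because the first
  case turns \<open>P\<close> into \<open>\<lambda>l. P (x # l)\<close>.\<close>

lemma subseq_sum_card:
  "card {idx. length idx = k \<and> sorted_wrt (<) idx \<and> set idx \<subseteq> {..<length p} \<and> P (map ((!) p) idx)}
     = subseq_sum (\<lambda>l. of_bool (P l)) k p"
proof (induction k arbitrary: p P)
  case 0
  have "{idx. length idx = 0 \<and> sorted_wrt (<) idx \<and> set idx \<subseteq> {..<length p} \<and> P (map ((!) p) idx)}
      = (if P [] then {[]} else {})"
    by auto
  then show ?case by simp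
next
  case (Suc k)
  note IH = Suc.IH
  show ?case
  proof (induction p)
    case Nil
    have "{idx. length idx = Suc k \<and> sorted_wrt (<) idx \<and> set idx \<subseteq> {..<length []} \<and> P (map ((!) []) idx)} = {}"
      by auto
    then show ?case by simp
  next
    case (Cons x p)
    let ?I = "\<lambda>k p P. {idx. length idx = k \<and> sorted_wrt (<) idx \<and> set idx \<subseteq> {..<length p} \<and> P (map ((!) p) idx)}"
    have fin: "finite (?I k p P)" for k p and P :: "'a list \<Rightarrow> bool"
      by (rule finite_subset[OF _ finite_lists_length_eq[of "{..<length p}" k]]) auto
    have mapS: "map ((!) (x # p)) (map Suc l) = map ((!) p) l" for l
      by simp
    have sS: "sorted_wrt (<) (map Suc l) = sorted_wrt (<) l" for l
      by (simp add: sorted_wrt_map)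
    have shift: "\<exists>l'. l = map Suc l'" if "0 \<notin> set l" for l
    proof
      show "l = map Suc (map (\<lambda>i. i - 1) l)"
        using that by (induction l) auto
    qed
    have "?I (Suc k) (x # p) P
        = (\<lambda>l. 0 # map Suc l) ` ?I k p (\<lambda>l. P (x # l)) \<union> map Suc ` ?I (Suc k) p P" (is "?L = ?R1 \<union> ?R2")
    proof (intro equalityI subsetI)
      fix idx assume a: "idx \<in> ?L"
      then obtain i l where il: "idx = i # l" by (cases idx) auto
      from a il have gt: "\<forall>j\<in>set l. i < j" by simp
      then have "0 \<notin> set l" by force
      then obtain l' where l': "l = map Suc l'" using shift by blast
      show "idx \<in> ?R1 \<union> ?R2"
      proof (cases i)
        case 0
        then have "l' \<in> ?I k p (\<lambda>l. P (x # l))"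
          using a il l' by (auto simp: sS comp_def)
        then show ?thesis using il l' 0 by blast
      next
        case (Suc i')
        then have "i' # l' \<in> ?I (Suc k) p P"
          using a il l' by (auto simp: sS comp_def)
        then have "map Suc (i' # l') \<in> ?R2" by blast
        then show ?thesis using il l' Suc by simp
      qed
    next
      fix idx assume "idx \<in> ?R1 \<union> ?R2"
      then show "idx \<in> ?L" by (auto simp: sS comp_def)
    qed
    moreover have "card ?R1 = card (?I k p (\<lambda>l. P (x # l)))"
      by (rule card_image) (auto simp: inj_on_def)
    moreover have "card ?R2 = card (?I (Suc k) p P)"
      by (rule card_image) (auto simp: inj_on_def)
    moreover have "card (?R1 \<union> ?R2) = card ?R1 + card ?R2"
      by (intro card_Un_disjoint finite_imageI fin) auto
    ultimately have "card (?I (Suc k) (x # p) P) = card (?I k p (\<lambda>l. P (x # l))) + card (?I (Suc k) p P)"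
      by presburger
    then show ?case using IH[of p "\<lambda>l. P (x # l)"] Cons by simp
  qed
qed

definition order_iso :: "nat list \<Rightarrow> nat list \<Rightarrow> bool" where
  "order_iso q l \<longleftrightarrow> (\<forall>s<length q. \<forall>t<length q. l ! s < l ! t \<longleftrightarrow> q ! s < q ! t)"

lemma num_occ_eq_subseq_sum:
  "num_occ q p = subseq_sum (\<lambda>l. of_bool (order_iso q l)) (length q) p"
proof -
  have "occurrences q p = {idx. length idx = length q \<and> sorted_wrt (<) idx \<and> set idx \<subseteq> {..<length p}
      \<and> order_iso q (map ((!) p) idx)}"
    by (auto simp: occurrences_def order_iso_def)
  then show ?thesis
    using subseq_sum_card[of "length q" p "order_iso q"] by (simp add: num_occ_def)
qed

text \<open>Distinctness of \<open>p\<close> passes to its subsequences, so an identity between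
  pattern indicators only has to be checked on two or three distinct entries.\<close>

lemma subseq_sum_cong:
  assumes "\<And>l. length l = k \<Longrightarrow> set l \<subseteq> set p \<Longrightarrow> distinct l \<Longrightarrow> f l = g l" "distinct p"
  shows "subseq_sum f k p = subseq_sum g k p"
  using assms
proof (induction f k p arbitrary: g rule: subseq_sum.induct)
  case (3 f k x p)
  have "subseq_sum (\<lambda>l. f (x # l)) k p = subseq_sum (\<lambda>l. g (x # l)) k p"
  proof (rule "3.IH"(1))
    fix l assume "length l = k" "set l \<subseteq> set p" "distinct l"
    then show "f (x # l) = g (x # l)" using "3.prems"(1)[of "x # l"] "3.prems"(2) by auto
  qed (use "3.prems" in auto)
  moreover have "subseq_sum f (Suc k) p = subseq_sum g (Suc k) p"
    by (rule "3.IH"(2)) (use "3.prems" in auto)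
  ultimately show ?case by simp
qed auto

lemma subseq_sum_add:
  "subseq_sum (\<lambda>l. f l + g l) k p = subseq_sum f k p + subseq_sum g k p"
  by (induction f k p arbitrary: g rule: subseq_sum.induct) auto

lemma subseq_sum_one: "subseq_sum (\<lambda>_. 1) k p = length p choose k"
  by (induction "\<lambda>_::'a list. 1::nat" k p rule: subseq_sum.induct) auto

lemma subseq_sum_zero: "subseq_sum (\<lambda>_. 0) k p = 0"
  by (induction "\<lambda>_::'a list. 0::nat" k p rule: subseq_sum.induct) auto

lemma subseq_sum_map: "subseq_sum f k (map h p) = subseq_sum (\<lambda>l. f (map h l)) k p"
proof (induction p arbitrary: f k)
  case Nil then show ?case by (cases k) auto
next
  case (Cons x p) then show ?case by (cases k) auto
qed

lemma subseq_sum_snoc: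
  "subseq_sum f (Suc k) (p @ [x]) = subseq_sum (\<lambda>l. f (l @ [x])) k p + subseq_sum f (Suc k) p"
proof (induction p arbitrary: f k)
  case Nil then show ?case by (cases k) auto
next
  case (Cons y p) then show ?case by (cases k) auto
qed

lemma subseq_sum_rev: "subseq_sum f k (rev p) = subseq_sum (\<lambda>l. f (rev l)) k p"
proof (induction p arbitrary: f k)
  case Nil then show ?case by (cases k) auto
next
  case (Cons x p) then show ?case by (cases k) (auto simp: subseq_sum_snoc)
qed

lemma subseq_sum_1: "subseq_sum f 1 p = sum_list (map (\<lambda>x. f [x]) p)"
  by (induction p) auto

text \<open>Each pair is contained in \<open>length p - 2\<close> triples.\<close>

lemma subseq_sum_pairs_in_triples:
  "subseq_sum (\<lambda>l. f [l ! 0, l ! 1] + f [l ! 0, l ! 2] + f [l ! 1, l ! 2]) 3 p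
     = (length p - 2) * subseq_sum f 2 p"
proof (induction p)
  case Nil
  then show ?case by (simp add: numeral_eq_Suc)
next
  case (Cons x p)
  \<comment> \<open>Triples with first entry \<open>x\<close>: a pair of \<open>x\<close> and a
    later entry leaves \<open>length p - 1\<close> choices for the remaining entry.\<close>
  have pr: "subseq_sum (\<lambda>l. f [x, l ! 0] + f [x, l ! 1]) 2 p = (length p - 1) * subseq_sum (\<lambda>l. f (x # l)) 1 p"
  proof (induction p)
    case Nil
    then show ?case by (simp add: numeral_eq_Suc)
  next
    case (Cons y p)
    have "sum_list (map (\<lambda>z. f [x, y] + f [x, z]) p) = length p * f [x, y] + sum_list (map (\<lambda>z. f [x, z]) p)"
      by (induction p) auto
    with Cons show ?case
      by (cases p) (auto simp: numeral_eq_Suc subseq_sum_1[simplified] algebra_simps)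
  qed
  have "subseq_sum (\<lambda>l. f [x, l ! 0] + f [x, l ! 1] + f [l ! 0, l ! 1]) 2 p
      = (length p - 1) * subseq_sum (\<lambda>l. f (x # l)) 1 p + subseq_sum (\<lambda>l. f [l ! 0, l ! 1]) 2 p"
    by (simp only: subseq_sum_add pr[unfolded subseq_sum_add])
  also have "subseq_sum (\<lambda>l. f [l ! 0, l ! 1]) 2 p = subseq_sum f 2 p"
    by (induction p) (simp_all add: numeral_eq_Suc subseq_sum_1[simplified])
  \<comment> \<open>Passing from \<open>length p - 2\<close> to \<open>length p - 1\<close> fails
    under truncated subtraction when \<open>p\<close> has at most one entry; there the sum over
    pairs is 0.\<close>
  finally show ?case using Cons
    by (cases p; cases "tl p") (auto simp: numeral_3_eq_3 numeral_2_eq_2 algebra_simps)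
qed

section \<open>Ballot recurrences\<close>

definition upper_sum :: "nat \<Rightarrow> nat \<Rightarrow> real" where
  "upper_sum N m = (\<Sum>k=m..N. real (N choose k))"

lemma upper_sum_step: "m \<le> Suc N \<Longrightarrow> upper_sum N m = upper_sum N (Suc m) + real (N choose m)"
  by (cases "m \<le> N") (auto simp: upper_sum_def sum.atLeast_Suc_atMost)

lemma upper_sum_Suc: "upper_sum (Suc N) (Suc m) = upper_sum N (Suc m) + upper_sum N m"
proof -
  have "upper_sum (Suc N) (Suc m) = (\<Sum>k=m..N. real (Suc N choose Suc k))"
    unfolding upper_sum_def by (rule sum.shift_bounds_cl_Suc_ivl)
  also have "\<dots> = upper_sum N m + (\<Sum>k=m..N. real (N choose Suc k))"
    by (simp add: upper_sum_def sum.distrib)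
  also have "(\<Sum>k=m..N. real (N choose Suc k)) = (\<Sum>k=Suc m..Suc N. real (N choose k))"
    by (rule sum.shift_bounds_cl_Suc_ivl[symmetric])
  also have "\<dots> = upper_sum N (Suc m)"
    by (auto simp: upper_sum_def)
  finally show ?thesis by simp
qed

text \<open>The two halves of row \<open>2 * n\<close> beside the middle agree by symmetry, and the
  entire row sums to \<open>4 ^ n\<close>.\<close>

lemma upper_sum_central: "2 * upper_sum (2 * n) (Suc n) = 4 ^ n - real (2 * n choose n)"
proof -
  have "(\<Sum>k=0..2*n. real (2 * n choose k)) = 4 ^ n"
  proof -
    have "(\<Sum>k=0..2*n. real (2 * n choose k)) = real (\<Sum>k\<le>2*n. 2 * n choose k)"
      by (simp add: atMost_atLeast0)
    also have "\<dots> = 4 ^ n"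
      by (subst choose_row_sum) (simp add: power_mult)
    finally show ?thesis .
  qed
  moreover have "(\<Sum>k=0..2*n. real (2 * n choose k))
      = (\<Sum>k\<in>{0..<n}. real (2 * n choose k)) + real (2 * n choose n) + upper_sum (2 * n) (Suc n)"
  proof -
    have "{0..2*n} = {0..<n} \<union> ({n} \<union> {Suc n..2*n})" by auto
    moreover have "sum f ({0..<n} \<union> ({n} \<union> {Suc n..2*n})) = sum f {0..<n} + (sum f {n} + sum f {Suc n..2*n})"
      for f :: "nat \<Rightarrow> real"
      by (subst sum.union_disjoint; (subst sum.union_disjoint)?) auto
    ultimately show ?thesis by (simp add: upper_sum_def)
  qed
  moreover have "(\<Sum>k\<in>{0..<n}. real (2 * n choose k)) = upper_sum (2 * n) (Suc n)"
    unfolding upper_sum_def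
  proof (rule sum.reindex_bij_witness[where i="\<lambda>k. 2*n-k" and j="\<lambda>k. 2*n-k"])
    fix k assume "k \<in> {0..<n}"
    then show "real (2 * n choose (2 * n - k)) = real (2 * n choose k)"
      by (subst binomial_symmetric[of k]) auto
  qed auto
  ultimately show ?thesis by simp
qed

text \<open>Recursion by the first entry of an avoider of type \<open>(Suc n, i)\<close>: an entry
  with \<open>j \<ge> i\<close> larger ones leaves an avoider of type \<open>(n, j)\<close>, while
  an entry among the \<open>i\<close> largest must be the maximum and leaves type
  \<open>(n, i - 1)\<close>. At \<open>i = 0\<close> these are the Catalan numbers.\<close>

fun ballot :: "nat \<Rightarrow> nat \<Rightarrow> nat" where
  "ballot 0 i = 1"
| "ballot (Suc n) i = (if i = 0 then 0 else ballot n (i - 1)) + (\<Sum>j=i..n. ballot n j)"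

text \<open>Total over the same permutations of a statistic that grows by \<open>w j\<close> when an
  entry with \<open>j\<close> larger ones is prepended. In the first summand the new entry is the
  maximum; it contributes no weight, in accordance with \<open>w 0 = 0\<close>.\<close>

fun ballot_stat :: "(nat \<Rightarrow> nat) \<Rightarrow> nat \<Rightarrow> nat \<Rightarrow> nat" where
  "ballot_stat w 0 i = 0"
| "ballot_stat w (Suc n) i = (if i = 0 then 0 else ballot_stat w n (i - 1))
     + (\<Sum>j=i..n. ballot_stat w n j + w j * ballot n j)"

text \<open>Taking differences in \<open>i\<close> removes the sum, so a candidate closed form only
  has to satisfy a local step and a boundary value at \<open>Suc n\<close>. Between
  \<open>i = 1\<close> and \<open>i = 0\<close> the term \<open>g 0\<close> merely moves into the
  sum, hence \<open>F 0 = F 1\<close>.\<close>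

lemma ballot_recurrence_unique:
  fixes F g v :: "nat \<Rightarrow> real"
  assumes "F (Suc n) = g n" "F 0 = F 1" "v 0 = 0"
    and step: "\<And>i. 1 \<le> i \<Longrightarrow> i \<le> n \<Longrightarrow> F i = F (Suc i) + g (i - 1) + v i"
    and "i \<le> Suc n"
  shows "F i = (if i = 0 then 0 else g (i - 1)) + (\<Sum>j=i..n. g j + v j)"
proof -
  have pos: "F i = g (i - 1) + (\<Sum>j=i..n. g j + v j)" if "i \<le> Suc n" "1 \<le> i" for i
    using that
  proof (induction rule: inc_induct)
    case base
    then show ?case using assms(1) by simp
  next
    case (step i)
    then show ?case using assms(4)[of i] by (simp add: sum.atLeast_Suc_atMost[of i])
  qed
  show ?thesis
  proof (cases "i = 0")
    case True
    then show ?thesis using pos[of 1] assms(2,3) by (simp add: sum.atLeast_Suc_atMost[of 0])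
  qed (use pos assms in auto)
qed

text \<open>Pascal's rule gives the local step, and the symmetry of row \<open>2 * n + 1\<close>
  makes the values at 0 and 1 agree.\<close>

lemma ballot_closed:
  "i \<le> n \<Longrightarrow> real (ballot n i) = real (2 * n - i choose n) - real (2 * n - i choose Suc n)"
proof (induction n arbitrary: i)
  case (Suc n)
  let ?E = "\<lambda>n i. real (2 * n - i choose n) - real (2 * n - i choose Suc n)"
  have "?E (Suc n) i = (if i = 0 then 0 else ?E n (i - 1)) + (\<Sum>j=i..n. ?E n j + 0)"
  proof (rule ballot_recurrence_unique)
    show "?E (Suc n) (Suc n) = ?E n n" by simp
    have "2 * Suc n - 1 = Suc (2 * n)" "2 * Suc n = Suc (Suc (2 * n))" by auto
    moreover have "Suc (2 * n) choose n = Suc (2 * n) choose Suc n"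
      using binomial_symmetric[of n "Suc (2 * n)"] by simp
    ultimately show "?E (Suc n) 0 = ?E (Suc n) 1" by simp
    fix i assume i: "1 \<le> i" "i \<le> n"
    obtain N where N: "2 * n - i = N" by simp
    have "2 * Suc n - i = Suc (Suc N)" "2 * Suc n - Suc i = Suc N" "2 * n - (i - 1) = Suc N"
      using i N by auto
    then show "?E (Suc n) i = ?E (Suc n) (Suc i) + ?E n (i - 1) + 0" by simp
  qed (use Suc in auto)
  also have "\<dots> = real (ballot (Suc n) i)"
    using Suc by (auto intro!: sum.cong)
  finally show ?case by simp
qed simp

section \<open>Closed forms for totals of weighted statistics\<close>

lemma choose_absorb_real: "real (Suc k) * real (n choose Suc k) = (real n - real k) * real (n choose k)"
proof (cases "k \<le> n")
  case True
  have "Suc k * (n choose Suc k) = (n - k) * (n choose k)"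
    by (metis binomial_absorb_comp binomial_absorption mult.commute)
  then have "real (Suc k * (n choose Suc k)) = real ((n - k) * (n choose k))" by (rule arg_cong)
  then show ?thesis using True by (simp only: of_nat_mult of_nat_diff)
next
  case False
  then show ?thesis by (simp add: binomial_eq_0)
qed

text \<open>In the variables \<open>N = 2 n - i\<close>, \<open>m = n + 1\<close> the recurrence is Pascal's rule with a source
term, which \<open>upper_sum N m\<close> satisfies without source. The remaining conditions on the polynomial
\<open>P\<close> are what is left after dividing by a common binomial coefficient.\<close>

lemma ballot_stat_closed:
  fixes P :: "real \<Rightarrow> real \<Rightarrow> real" and w :: "nat \<Rightarrow> nat" and c :: real
  defines "F \<equiv> \<lambda>n i. (real i + 1) * (c * upper_sum (2 * n - i) (Suc n) + P (real n) (real i) * real (2 * n - i - 1 choose n))"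
  assumes w0: "w 0 = 0"
    and one: "P 1 0 + c = 0"
    and bdry: "\<And>n. n \<ge> 1 \<Longrightarrow> (2 * n + 1) * (c + P (n + 1) 0) = 2 * n * P (n + 1) 1"
    and step: "\<And>n i. 1 \<le> i \<Longrightarrow> i \<le> n \<Longrightarrow>
       (i + 1) * (c + P (real n + 1) i) * (2 * real n + 1 - i)
       = (i + 2) * P (real n + 1) (i + 1) * (real n - i) + i * (c * (2 * real n + 1 - i) + P n (i - 1) * (n + 1))
          + w i * (real i + 1)"
  shows "1 \<le> n \<Longrightarrow> i \<le> n \<Longrightarrow> real (ballot_stat w n i) = F n i"
proof (induction n arbitrary: i)
  case (Suc n)
  show ?case
  proof (cases "n = 0")
    \<comment> \<open>The claim starts at 1, since at \<open>n = 0\<close> the truncated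
      \<open>2 * n - i - 1\<close> would give \<open>0 choose 0 = 1\<close>. The condition
      \<open>one\<close> is the value at \<open>n = 1\<close>, \<open>i = 0\<close>.\<close>
    case True
    with Suc have "i = 0 \<or> i = 1" by auto
    then show ?thesis using True one w0
      by (auto simp: F_def upper_sum_def numeral_2_eq_2)
  next
    case False
    let ?e = "\<lambda>i. real (2 * n - i choose n) - real (2 * n - i choose Suc n)"
    have "F (Suc n) i = (if i = 0 then 0 else F n (i - 1)) + (\<Sum>j=i..n. F n j + real (w j) * ?e j)"
    proof (rule ballot_recurrence_unique)
      show "F (Suc n) (Suc n) = F n n"
        using False by (simp add: F_def upper_sum_def binomial_eq_0)
      have N: "2 * Suc n - 0 = Suc (Suc (2 * n))" "2 * Suc n - 1 = Suc (2 * n)" by auto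
      have u: "upper_sum (Suc (Suc (2 * n))) (Suc (Suc n))
          = 2 * upper_sum (Suc (2 * n)) (Suc (Suc n)) + real (Suc (2 * n) choose Suc n)"
        using upper_sum_Suc[of "Suc (2 * n)" "Suc n"] upper_sum_step[of "Suc n" "Suc (2 * n)"] by simp
      define B where "B = real (2 * n choose Suc n)"
      define B' where "B' = real (2 * n choose n)"
      have BB: "real (Suc n) * B = n * B'"
        using choose_absorb_real[of n "2 * n"] by (simp add: B_def B'_def)
      have s: "real (Suc (2 * n) choose Suc n) = B' + B" by (simp add: B_def B'_def)
      \<comment> \<open>By this relation, \<open>bdry\<close> multiplied by \<open>B\<close> is
        \<open>n\<close> times the equation that \<open>F (Suc n) 0 = F (Suc n) 1\<close> amounts
        to.\<close>
      have "(2 * real n + 1) * B = n * (B' + B)" using BB by (simp add: algebra_simps)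
      moreover have "(2 * real n + 1) * (c + P (real n + 1) 0) = 2 * real n * P (real n + 1) 1"
        using False by (intro bdry) simp
      ultimately have "real n * ((c + P (real n + 1) 0) * (B' + B)) = n * (2 * P (real n + 1) 1 * B)"
        by algebra
      then have "(c + P (real n + 1) 0) * (B' + B) = 2 * P (real n + 1) 1 * B"
        using False by simp
      then show "F (Suc n) 0 = F (Suc n) 1"
        unfolding F_def N u s by (simp add: B_def B'_def algebra_simps)
      show "real (w 0) * ?e 0 = 0" using w0 by simp
      fix i assume i: "1 \<le> i" "i \<le> n"
      obtain N where N: "2 * n - i = Suc N" using i False by (cases "2 * n - i") auto
      have N': "2 * Suc n - i = Suc (Suc (Suc N))" "2 * Suc n - Suc i = Suc (Suc N)"
          "2 * n - (i - 1) = Suc (Suc N)" "Suc (Suc (Suc N)) - 1 = Suc (Suc N)" "Suc (Suc N) - 1 = Suc N"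
        using i N by auto
      define b where "b = real (Suc N choose n)"
      define d where "d = real (Suc N choose Suc n)"
      define t where "t = upper_sum (Suc (Suc N)) (Suc (Suc n))"
      have NR: "real (Suc N) = 2 * real n - real i"
        using N i by (metis of_nat_diff of_nat_mult of_nat_numeral nat_le_iff_add trans_le_add1 mult_2)
      have bd: "(real n + 1) * d = (real n - i) * b"
        using choose_absorb_real[of n "Suc N"] unfolding NR b_def d_def by (simp add: algebra_simps)
      have c1: "real (Suc (Suc N) choose Suc n) = b + d" by (simp add: b_def d_def)
      have t1: "upper_sum (Suc (Suc N)) (Suc n) = t + b + d"
        using upper_sum_step[of "Suc n" "Suc (Suc N)"] N i c1 by (simp add: t_def)
      have t2: "upper_sum (Suc (Suc (Suc N))) (Suc (Suc n)) = 2 * t + b + d"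
        using upper_sum_Suc[of "Suc (Suc N)" "Suc n"] t1 by (simp add: t_def)
      \<comment> \<open>The coefficients of \<open>t\<close> agree because
        \<open>2 * (i + 1) = (i + 2) + i\<close>. After multiplication by \<open>n + 1\<close>, the
        relation \<open>bd\<close> makes every remaining term a multiple of \<open>b\<close>, and
        what is left is the hypothesis \<open>step\<close> times \<open>b\<close>.\<close>
      have "(real n + 1) * ((real i + 1) * (c * (2 * t + b + d) + P (real n + 1) i * (b + d)))
          = (real n + 1) * ((real i + 2) * (c * t + P (real n + 1) (real i + 1) * d)
             + i * (c * (t + b + d) + P n (real i - 1) * b) + w i * (b - d))"
        using step[OF i] bd by algebra
      then have "(real i + 1) * (c * (2 * t + b + d) + P (real n + 1) i * (b + d))
          = (real i + 2) * (c * t + P (real n + 1) (real i + 1) * d)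
             + i * (c * (t + b + d) + P n (real i - 1) * b) + w i * (b - d)"
        by (subst (asm) mult_left_cancel) (use of_nat_0_le_iff[of n, where ?'a = real] in linarith, assumption)
      moreover have "F (Suc n) i = (real i + 1) * (c * (2 * t + b + d) + P (real n + 1) i * (b + d))"
        unfolding F_def N' t2 c1 by (simp add: add.commute)
      moreover have "F (Suc n) (Suc i) = (real i + 2) * (c * t + P (real n + 1) (real i + 1) * d)"
        unfolding F_def N' t_def d_def by (simp add: add.commute)
      moreover have "F n (i - 1) = i * (c * (t + b + d) + P n (real i - 1) * b)"
        unfolding F_def N' t1 b_def using i by (simp add: of_nat_diff)
      ultimately show "F (Suc n) i = F (Suc n) (Suc i) + F n (i - 1) + real (w i) * ?e i"
        unfolding N by (simp add: b_def d_def)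
    qed (use Suc in auto)
    also have "\<dots> = real (ballot_stat w (Suc n) i)"
      using Suc False by (auto intro!: sum.cong arg_cong2[of _ _ _ _ "(+)"] simp: ballot_closed)
    finally show ?thesis by simp
  qed
qed simp

text \<open>Weight \<open>j\<close> belongs to the pattern 12. The conditions of
  \<open>ballot_stat_closed\<close> are linear in \<open>c\<close> and \<open>P\<close>; a solution
  is \<open>c = 1 / 2\<close> with \<open>P\<close> linear in \<open>i\<close>.\<close>

lemma ballot_stat_id_closed:
  assumes "1 \<le> n"
  shows "2 * real (ballot_stat (\<lambda>j. j) n 0) = upper_sum (2 * n) (Suc n) - real (2 * n - 1 choose n)"
proof -
  have "real (ballot_stat (\<lambda>j. j) n 0) = (real 0 + 1) * (1 / 2 * upper_sum (2 * n - 0) (Suc n)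
      + (real 0 - 1) / 2 * real (2 * n - 0 - 1 choose n))"
    by (rule ballot_stat_closed[where P = "\<lambda>n i. (i - 1) / 2"])
      (use assms in \<open>auto simp: field_simps\<close>)
  then show ?thesis by simp
qed

lemma choose_two_real: "real (n choose 2) = real n * (real n - 1) / 2"
  by (induction n) (simp_all add: numeral_2_eq_2 field_simps)

text \<open>Weight \<open>j choose 2\<close> belongs to the pattern 132. The source term is now
  quadratic in \<open>i\<close> before the common factor, and \<open>P\<close> is taken quadratic in
  \<open>i\<close> and linear in \<open>n\<close>. Although the value at \<open>i = 0\<close> is the
  one wanted, the recurrence couples all \<open>i\<close>.\<close>

lemma ballot_stat_choose_two_closed:
  assumes "1 \<le> n"
  shows "4 * real (ballot_stat (\<lambda>j. j choose 2) n 0)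
     = (2 * real n + 1) * real (2 * n - 1 choose n) - 3 * upper_sum (2 * n) (Suc n)"
proof -
  have "real (ballot_stat (\<lambda>j. j choose 2) n 0) = (real 0 + 1) * (- 3 / 4 * upper_sum (2 * n - 0) (Suc n)
      + (real 0 ^ 2 / 6 - 2 * real 0 / 3 + 1 / 4 + real n / 2) * real (2 * n - 0 - 1 choose n))"
    by (rule ballot_stat_closed[where P = "\<lambda>n i. i ^ 2 / 6 - 2 * i / 3 + 1 / 4 + n / 2"])
      (use assms in \<open>simp_all add: choose_two_real, simp_all add: field_simps power2_eq_square\<close>)
  then show ?thesis by (simp add: algebra_simps)
qed

section \<open>Prepending an entry to a 123-avoiding permutation\<close>

text \<open>For distinct entries this is avoidance of 123: \<open>x\<close> starts no increasing
  triple iff the larger entries after it decrease.\<close>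

fun avoids_inc3 :: "'a::linorder list \<Rightarrow> bool" where
  "avoids_inc3 [] \<longleftrightarrow> True"
| "avoids_inc3 (x # p) \<longleftrightarrow> sorted_wrt (>) (filter ((<) x) p) \<and> avoids_inc3 p"

text \<open>Avoiders of type \<open>(card A, i)\<close>, where \<open>i\<close> is the number of
  elements of \<open>A\<close> above \<open>t\<close>. Arbitrary entry sets and thresholds avoid
  relabelling after the first entry is removed; the threshold may lie outside
  \<open>A\<close>.\<close>

definition top_dec :: "'a::linorder set \<Rightarrow> 'a \<Rightarrow> 'a list set" where
  "top_dec A t = {p \<in> permutations_of_set A. avoids_inc3 p \<and> sorted_wrt (>) (filter ((<) t) p)}"

lemma finite_top_dec: "finite (top_dec A t)"
  by (simp add: top_dec_def)

lemma sorted_wrt_filter_mono: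
  assumes "sorted_wrt R (filter P p)" "\<And>y. Q y \<Longrightarrow> P y"
  shows "sorted_wrt R (filter Q p)"
proof -
  have "filter Q p = filter Q (filter P p)"
    using assms(2) by (induction p) auto
  then show ?thesis using assms(1) sorted_wrt_filter by metis
qed

text \<open>Let \<open>x\<close> be the first entry. If \<open>x \<le> t\<close>, the decrease of
  the entries above \<open>x\<close> already covers those above \<open>t\<close>. If
  \<open>x > t\<close>, all other entries above \<open>t\<close> must be smaller than
  \<open>x\<close>, so \<open>x\<close> is the maximum and the threshold stays.\<close>

lemma top_dec_decomp:
  assumes "finite A" "A \<noteq> {}"
  shows "top_dec A t = (\<Union>x\<in>{x\<in>A. x \<le> t}. Cons x ` top_dec (A - {x}) x)
     \<union> (if t < Max A then Cons (Max A) ` top_dec (A - {Max A}) t else {})" (is "_ = ?R")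
proof (intro equalityI subsetI)
  fix p assume p: "p \<in> top_dec A t"
  then have sp: "set p = A" "distinct p" by (auto simp: top_dec_def permutations_of_set_def)
  with assms obtain x l where xl: "p = x # l" by (cases p) auto
  from sp xl have l: "l \<in> permutations_of_set (A - {x})" "x \<in> A"
    by (auto simp: permutations_of_set_def)
  show "p \<in> ?R"
  proof (cases "x \<le> t")
    case True
    then have "l \<in> top_dec (A - {x}) x" using p xl l by (auto simp: top_dec_def)
    then show ?thesis using True xl l by auto
  next
    case False
    then have less: "y < x" if "y \<in> set l" "t < y" for y
      using p xl that by (auto simp: top_dec_def split: if_splits)
    have "\<forall>y\<in>A. y \<le> x"
    proof
      fix y assume "y \<in> A"
      then show "y \<le> x" using less[of y] False sp xl by (cases "t < y") auto
    qed
    then have "Max A = x" using l assms by (intro Max_eqI) auto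
    moreover have "l \<in> top_dec (A - {x}) t" using p xl l False by (auto simp: top_dec_def split: if_splits)
    ultimately show ?thesis using False xl by auto
  qed
next
  fix p assume "p \<in> ?R"
  then consider (le) x l where "x \<in> A" "x \<le> t" "p = x # l" "l \<in> top_dec (A - {x}) x"
    | (max) l where "t < Max A" "p = Max A # l" "l \<in> top_dec (A - {Max A}) t"
    by (auto split: if_splits)
  then show "p \<in> top_dec A t"
  proof cases
    case le
    have "set l = A - {x}" "distinct l" and l: "avoids_inc3 l" "sorted_wrt (>) (filter ((<) x) l)"
      using le(4) by (auto simp: top_dec_def permutations_of_set_def)
    then have "set p = A" "distinct p" using le(1,3) by auto
    moreover have "sorted_wrt (>) (filter ((<) t) l)"
      by (rule sorted_wrt_filter_mono[OF l(2)]) (use le(2) in auto)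
    ultimately show ?thesis using l le(2,3) by (simp add: top_dec_def permutations_of_set_def leD)
  next
    case max
    have MA: "Max A \<in> A" using assms by simp
    have l: "set l = A - {Max A}" "distinct l"
      and av: "avoids_inc3 l" "sorted_wrt (>) (filter ((<) t) l)"
      using max(3) by (auto simp: top_dec_def permutations_of_set_def)
    then have "set p = A" "distinct p" using max(2) MA by auto
    moreover have lt: "y < Max A" if "y \<in> set l" for y
    proof -
      have "y \<in> A" "y \<noteq> Max A" using that l(1) by auto
      then show ?thesis using Max_ge[OF assms(1), of y] by simp
    qed
    moreover have "filter ((<) (Max A)) l = []"
      unfolding filter_empty_conv using lt less_asym by blast
    ultimately show ?thesis using av max(1,2) by (simp add: top_dec_def permutations_of_set_def)
  qed
qed

lemma sum_top_dec:
  assumes "finite A" "A \<noteq> {}"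
  shows "sum f (top_dec A t) = (\<Sum>x\<in>{x\<in>A. x \<le> t}. \<Sum>p\<in>top_dec (A - {x}) x. f (x # p))
     + (if t < Max A then \<Sum>p\<in>top_dec (A - {Max A}) t. f (Max A # p) else (0::nat))"
proof -
  let ?U = "\<Union>x\<in>{x\<in>A. x \<le> t}. Cons x ` top_dec (A - {x}) x"
  let ?V = "if t < Max A then Cons (Max A) ` top_dec (A - {Max A}) t else {}"
  have "sum f (top_dec A t) = sum f ?U + sum f ?V"
    unfolding top_dec_decomp[OF assms]
    by (rule sum.union_disjoint) (use assms in \<open>auto simp: finite_top_dec\<close>)
  moreover have "sum f ?U = (\<Sum>x\<in>{x\<in>A. x \<le> t}. sum f (Cons x ` top_dec (A - {x}) x))"
    by (rule sum.UNION_disjoint) (use assms in \<open>auto simp: finite_top_dec\<close>)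
  moreover have "sum f (Cons x ` B) = (\<Sum>p\<in>B. f (x # p))" for x B
    by (simp add: sum.reindex)
  ultimately show ?thesis by (simp add: if_distrib)
qed

text \<open>The number of larger elements strictly decreases in \<open>x\<close>, hence is
  injective, and the two sets have equal size. This turns sums over first entries into sums over
  \<open>j = i..n\<close>.\<close>

lemma bij_betw_card_greater:
  fixes A :: "'a::linorder set"
  assumes "finite A" "card A = Suc n"
  shows "bij_betw (\<lambda>x. card {y\<in>A. x < y}) {x\<in>A. x \<le> t} {card {y\<in>A. t < y}..n}"
proof -
  let ?r = "\<lambda>x. card {y\<in>A. x < y}"
  have anti: "?r x' < ?r x" if "x \<in> A" "x' \<in> A" "x < x'" for x x'
    by (rule psubset_card_mono) (use assms that in auto)
  have inj: "inj_on ?r {x\<in>A. x \<le> t}"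
    by (rule inj_onI) (metis (mono_tags, lifting) anti less_irrefl mem_Collect_eq neqE)
  have sub: "?r ` {x\<in>A. x \<le> t} \<subseteq> {?r t..n}"
  proof
    fix j assume "j \<in> ?r ` {x\<in>A. x \<le> t}"
    then obtain x where x: "x \<in> A" "x \<le> t" "j = ?r x" by auto
    have "?r t \<le> ?r x" by (rule card_mono) (use assms x in auto)
    moreover have "?r x < card A" by (rule psubset_card_mono) (use assms x in auto)
    ultimately show "j \<in> {?r t..n}" using x assms by auto
  qed
  have "A = {x\<in>A. x \<le> t} \<union> {x\<in>A. t < x}" by auto
  then have "card A = card {x\<in>A. x \<le> t} + ?r t"
    using assms(1) card_Un_disjoint[of "{x\<in>A. x \<le> t}" "{x\<in>A. t < x}"] by force
  then have "card {x\<in>A. x \<le> t} = card {?r t..n}" using assms by auto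
  then have "?r ` {x\<in>A. x \<le> t} = {?r t..n}"
    using sub inj by (intro card_subset_eq) (auto simp: card_image)
  with inj show ?thesis by (simp add: bij_betw_def)
qed

lemma card_greater_Diff_self: "card {y\<in>A - {x}. x < y} = card {y\<in>A. x < (y::'a::linorder)}"
  by (rule arg_cong[of _ _ card]) auto

lemma card_greater_Diff_Max:
  fixes A :: "'a::linorder set"
  assumes "finite A" "A \<noteq> {}" "t < Max A"
  shows "card {y\<in>A. t < y} = Suc (card {y\<in>A - {Max A}. t < y})"
proof -
  have "{y\<in>A. t < y} = insert (Max A) {y\<in>A - {Max A}. t < y}" using assms(3) Max_in[OF assms(1,2)] by blast
  moreover have "finite {y\<in>A - {Max A}. t < y}" using assms by simp
  ultimately show ?thesis by simp
qed

lemma card_greater_eq_0_iff: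
  fixes A :: "'a::linorder set"
  assumes "finite A" "A \<noteq> {}"
  shows "card {y\<in>A. t < y} = 0 \<longleftrightarrow> \<not> t < Max A"
  using assms by (auto simp: not_less)

text \<open>Common core of the count and of the statistics: if \<open>G\<close> depends on the
  threshold only through its rank, the decomposition by the first entry becomes the ballot
  recursion. Removing the maximum lowers a positive rank by one, removing \<open>x\<close> keeps the
  rank of \<open>x\<close>.\<close>

lemma sum_top_dec_rank:
  fixes A :: "'a::linorder set" and G :: "'a set \<Rightarrow> 'a \<Rightarrow> nat"
  assumes A: "finite A" "card A = Suc n"
    and G: "\<And>x t. x \<in> A \<Longrightarrow> G (A - {x}) t = g (card {y\<in>A - {x}. t < y})"
  shows "(\<Sum>x\<in>{x\<in>A. x \<le> t}. G (A - {x}) x) + (if t < Max A then G (A - {Max A}) t else 0)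
     = (let i = card {y\<in>A. t < y} in (if i = 0 then 0 else g (i - 1)) + (\<Sum>j=i..n. g j))"
proof -
  have ne: "A \<noteq> {}" using A by auto
  have "(\<Sum>x\<in>{x\<in>A. x \<le> t}. G (A - {x}) x) = (\<Sum>x\<in>{x\<in>A. x \<le> t}. g (card {y\<in>A. x < y}))"
    by (rule sum.cong) (use G card_greater_Diff_self[of A] in auto)
  also have "\<dots> = (\<Sum>j=card {y\<in>A. t < y}..n. g j)"
    by (rule sum.reindex_bij_betw[OF bij_betw_card_greater[OF A]])
  finally show ?thesis
    using G[of "Max A"] card_greater_Diff_Max[OF A(1) ne] card_greater_eq_0_iff[OF A(1) ne, of t] A ne
    by (auto simp: Let_def)
qed

lemma card_top_dec:
  "finite A \<Longrightarrow> card (top_dec A t) = ballot (card A) (card {y\<in>A. t < y})"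
proof (induction "card A" arbitrary: A t)
  case 0
  then have "top_dec A t = {[]}" by (auto simp: top_dec_def)
  then show ?case using 0 by simp
next
  case (Suc n)
  have IH: "card (top_dec (A - {x}) t) = ballot n (card {y\<in>A - {x}. t < y})" if "x \<in> A" for x t
  proof -
    have c: "n = card (A - {x})" using Suc that by simp
    show ?thesis using Suc.hyps(1)[OF c, of t] Suc.prems c by simp
  qed
  have "card (top_dec A t) = (\<Sum>x\<in>{x\<in>A. x \<le> t}. card (top_dec (A - {x}) x))
     + (if t < Max A then card (top_dec (A - {Max A}) t) else 0)"
    using sum_top_dec[of A "\<lambda>_. 1" t] Suc by fastforce
  also have "\<dots> = ballot (Suc n) (card {y\<in>A. t < y})"
    by (subst sum_top_dec_rank[where G = "\<lambda>A t. card (top_dec A t)" and g = "ballot n" and n = n])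
      (use Suc.prems Suc.hyps(2)[symmetric] IH in \<open>simp_all add: Let_def del: card_0_eq\<close>)
  finally show ?case unfolding Suc.hyps(2) .
qed

text \<open>All members of \<open>top_dec (A - {x}) x\<close> gain the same weight from prepending
  \<open>x\<close>, because the number of entries above \<open>x\<close> depends only on the entry
  set. A prepended maximum gains \<open>w 0 = 0\<close>.\<close>

lemma sum_stat_top_dec:
  assumes f0: "f [] = 0"
    and f: "\<And>x p. distinct p \<Longrightarrow> sorted_wrt (>) (filter ((<) x) p) \<Longrightarrow>
       f (x # p) = f p + w (length (filter ((<) x) p))"
    and w: "w 0 = 0"
  shows "finite A \<Longrightarrow> sum f (top_dec A t) = ballot_stat w (card A) (card {y\<in>A. t < y})"
proof (induction "card A" arbitrary: A t)
  case 0
  then have "top_dec A t = {[]}" by (auto simp: top_dec_def)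
  then show ?case using 0 f0 by simp
next
  case (Suc n)
  note A = Suc.prems
  have ne: "A \<noteq> {}" using Suc.hyps by auto
  have IH: "sum f (top_dec (A - {x}) t) = ballot_stat w n (card {y\<in>A - {x}. t < y})" if "x \<in> A" for x t
  proof -
    have c: "n = card (A - {x})" using Suc that by simp
    show ?thesis using Suc.hyps(1)[OF c, of t] Suc.prems c by simp
  qed
  have len: "length (filter ((<) x) p) = card {y\<in>A - {x}. x < y}" if "p \<in> top_dec (A - {x}) t" for x p t
  proof -
    have "distinct p" "set p = A - {x}" using that by (auto simp: top_dec_def permutations_of_set_def)
    then show ?thesis by (auto simp: distinct_length_filter intro: arg_cong[of _ _ card])
  qed
  have le: "(\<Sum>p\<in>top_dec (A - {x}) x. f (x # p))
     = sum f (top_dec (A - {x}) x) + w (card {y\<in>A - {x}. x < y}) * card (top_dec (A - {x}) x)" for x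
  proof -
    have "(\<Sum>p\<in>top_dec (A - {x}) x. f (x # p)) = (\<Sum>p\<in>top_dec (A - {x}) x. f p + w (card {y\<in>A - {x}. x < y}))"
      by (rule sum.cong[OF refl], subst f) (auto simp: len, auto simp: top_dec_def permutations_of_set_def)
    then show ?thesis by (simp add: sum.distrib)
  qed
  have mx: "(\<Sum>p\<in>top_dec (A - {Max A}) t. f (Max A # p)) = sum f (top_dec (A - {Max A}) t)"
  proof (rule sum.cong[OF refl])
    fix p assume p: "p \<in> top_dec (A - {Max A}) t"
    then have sp: "set p \<subseteq> A" "distinct p" by (auto simp: top_dec_def permutations_of_set_def)
    then have "filter ((<) (Max A)) p = []" using A by (auto simp: filter_empty_conv not_less)
    then show "f (Max A # p) = f p" using f[OF sp(2), of "Max A"] w by simp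
  qed
  let ?r = "\<lambda>x. card {y\<in>A. x < y}"
  have "sum f (top_dec A t) = ((\<Sum>x\<in>{x\<in>A. x \<le> t}. sum f (top_dec (A - {x}) x))
     + (if t < Max A then sum f (top_dec (A - {Max A}) t) else 0))
     + (\<Sum>x\<in>{x\<in>A. x \<le> t}. w (?r x) * ballot n (?r x))"
  proof -
    have "(\<Sum>x\<in>{x\<in>A. x \<le> t}. \<Sum>p\<in>top_dec (A - {x}) x. f (x # p))
       = (\<Sum>x\<in>{x\<in>A. x \<le> t}. sum f (top_dec (A - {x}) x) + w (?r x) * ballot n (?r x))"
    proof (rule sum.cong[OF refl])
      fix x assume "x \<in> {x\<in>A. x \<le> t}"
      then have "card (A - {x}) = n" using Suc by simp
      then have "card (top_dec (A - {x}) x) = ballot n (?r x)"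
        using card_top_dec[of "A - {x}" x] A card_greater_Diff_self[of A x] by simp
      then show "(\<Sum>p\<in>top_dec (A - {x}) x. f (x # p)) = sum f (top_dec (A - {x}) x) + w (?r x) * ballot n (?r x)"
        using le[of x] card_greater_Diff_self[of A x] by simp
    qed
    then show ?thesis unfolding sum_top_dec[OF A ne] mx by (simp add: sum.distrib)
  qed
  also have "(\<Sum>x\<in>{x\<in>A. x \<le> t}. w (?r x) * ballot n (?r x)) = (\<Sum>j=?r t..n. w j * ballot n j)"
    by (rule sum.reindex_bij_betw[OF bij_betw_card_greater]) (use Suc in auto)
  also have "(\<Sum>x\<in>{x\<in>A. x \<le> t}. sum f (top_dec (A - {x}) x))
     + (if t < Max A then sum f (top_dec (A - {Max A}) t) else 0)
    = (if ?r t = 0 then 0 else ballot_stat w n (?r t - 1)) + (\<Sum>j=?r t..n. ballot_stat w n j)"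
    by (subst sum_top_dec_rank[where G = "\<lambda>A t. sum f (top_dec A t)" and g = "ballot_stat w n" and n = n])
      (use Suc.prems Suc.hyps(2)[symmetric] IH in \<open>simp_all add: Let_def del: card_0_eq\<close>)
  also have "\<dots> + (\<Sum>j=?r t..n. w j * ballot n j) = ballot_stat w (Suc n) (?r t)"
    by (simp add: sum.distrib)
  finally show ?case unfolding Suc.hyps(2) .
qed

section \<open>Occurrences of patterns\<close>

text \<open>Serves to reduce occurrences that start with a prepended smallest letter
  \<open>x\<close> to subsequences of the entries above \<open>x\<close>.\<close>

lemma subseq_sum_filter:
  "subseq_sum (\<lambda>l. of_bool ((\<forall>y\<in>set l. P y) \<and> Q l)) k p = subseq_sum (\<lambda>l. of_bool (Q l)) k (filter P p)"
proof (induction p arbitrary: k Q)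
  case Nil
  then show ?case by (cases k) auto
next
  case (Cons x p)
  show ?case
  proof (cases k)
    case (Suc k')
    show ?thesis
    proof (cases "P x")
      case True
      then show ?thesis
        using Suc Cons.IH[of "\<lambda>l. Q (x # l)" k'] Cons.IH[of Q k] by simp
    next
      case False
      then show ?thesis using Suc Cons.IH[of Q k] by (simp add: subseq_sum_zero)
    qed
  qed simp
qed

text \<open>Pairwise sortedness passes to every subsequence, so each one counts.\<close>

lemma subseq_sum_sorted_wrt:
  "sorted_wrt R p \<Longrightarrow> subseq_sum (\<lambda>l. of_bool (sorted_wrt R l)) k p = length p choose k"
proof (induction p arbitrary: k)
  case Nil
  then show ?case by (cases k) auto
next
  case (Cons x p)
  show ?case
  proof (cases k)
    case (Suc k')
    have "filter (R x) p = p" using Cons.prems by (simp add: filter_id_conv)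
    then show ?thesis
      using Suc Cons subseq_sum_filter[of "R x" "sorted_wrt R" k' p] by simp
  qed simp
qed

lemma subseq_sum_increasing_pairs_eq_0_iff:
  fixes p :: "'a::linorder list"
  assumes "distinct p"
  shows "subseq_sum (\<lambda>l. of_bool (sorted_wrt (<) l)) 2 p = 0 \<longleftrightarrow> sorted_wrt (>) p"
  using assms
proof (induction p)
  case Nil
  then show ?case by (simp add: numeral_2_eq_2)
next
  case (Cons x p)
  have "subseq_sum (\<lambda>l. of_bool (sorted_wrt (<) (x # l))) 1 p = length (filter ((<) x) p)"
    unfolding sorted_wrt.simps(2) subseq_sum_filter
    by (subst subseq_sum_1) (simp add: sum_list_triv)
  moreover have "length (filter ((<) x) p) = 0 \<longleftrightarrow> (\<forall>y\<in>set p. y < x)"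
    using Cons.prems by (auto simp: filter_empty_conv not_less order.order_iff_strict)
  ultimately show ?case using Cons by (auto simp: numeral_2_eq_2)
qed

section \<open>Patterns of length 2 and 3 under prepending\<close>

lemma list_length_2E: "length l = 2 \<Longrightarrow> (\<And>a b. l = [a, b] \<Longrightarrow> thesis) \<Longrightarrow> thesis"
  by (auto simp: length_Suc_conv numeral_2_eq_2)

lemma list_length_3E: "length l = 3 \<Longrightarrow> (\<And>a b c. l = [a, b, c] \<Longrightarrow> thesis) \<Longrightarrow> thesis"
  by (auto simp: length_Suc_conv numeral_3_eq_3)

lemma order_iso_simps:
  "order_iso [1, 2] [a, b] \<longleftrightarrow> a < b"
  "order_iso [1, 2, 3] [a, b, c] \<longleftrightarrow> a < b \<and> b < c"
  "order_iso [1, 3, 2] [a, b, c] \<longleftrightarrow> a < c \<and> c < b"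
  "order_iso [2, 1, 3] [a, b, c] \<longleftrightarrow> b < a \<and> a < c"
  "order_iso [2, 3, 1] [a, b, c] \<longleftrightarrow> c < a \<and> a < b"
  "order_iso [3, 1, 2] [a, b, c] \<longleftrightarrow> b < c \<and> c < a"
  "order_iso [3, 2, 1] [a, b, c] \<longleftrightarrow> c < b \<and> b < a"
  unfolding order_iso_def by (auto simp: All_less_Suc)

lemma num_occ_length_2: "num_occ [a, b] p = subseq_sum (\<lambda>l. of_bool (order_iso [a, b] l)) 2 p"
  by (simp add: num_occ_eq_subseq_sum numeral_2_eq_2)

lemma num_occ_length_3: "num_occ [a, b, c] p = subseq_sum (\<lambda>l. of_bool (order_iso [a, b, c] l)) 3 p"
  by (simp add: num_occ_eq_subseq_sum numeral_3_eq_3)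

lemma num_occ_12_Cons: "num_occ [1, 2] (x # p) = num_occ [1, 2] p + length (filter ((<) x) p)"
proof -
  have "subseq_sum (\<lambda>l. of_bool (order_iso [1, 2] (x # l))) 1 p = length (filter ((<) x) p)"
    by (subst subseq_sum_1) (induction p, auto simp: order_iso_simps[simplified])
  then show ?thesis by (simp add: num_occ_eq_subseq_sum)
qed

text \<open>In a new occurrence \<open>x\<close> is the smallest letter, and the other two are
  entries above \<open>x\<close> in decreasing order. Those entries decrease by assumption, so any
  two of them will do.\<close>

lemma num_occ_132_Cons:
  assumes "distinct p" "sorted_wrt (>) (filter ((<) x) p)"
  shows "num_occ [1, 3, 2] (x # p) = num_occ [1, 3, 2] p + (length (filter ((<) x) p) choose 2)"
proof -
  have "subseq_sum (\<lambda>l. of_bool (order_iso [1, 3, 2] (x # l))) 2 p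
      = subseq_sum (\<lambda>l. of_bool ((\<forall>y\<in>set l. x < y) \<and> sorted_wrt (>) l)) 2 p"
    by (rule subseq_sum_cong[OF _ assms(1)]) (auto elim!: list_length_2E simp: order_iso_simps[simplified])
  then show ?thesis
    using subseq_sum_sorted_wrt[OF assms(2)]
    by (simp add: num_occ_eq_subseq_sum subseq_sum_filter numeral_2_eq_2)
qed

lemma num_occ_123_eq_0_iff: "distinct p \<Longrightarrow> num_occ [1, 2, 3] p = 0 \<longleftrightarrow> avoids_inc3 p"
proof (induction p)
  case Nil
  then show ?case by (simp add: num_occ_eq_subseq_sum)
next
  case (Cons x p)
  have "subseq_sum (\<lambda>l. of_bool (order_iso [1, 2, 3] (x # l))) 2 p
      = subseq_sum (\<lambda>l. of_bool ((\<forall>y\<in>set l. x < y) \<and> sorted_wrt (<) l)) 2 p"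
    by (rule subseq_sum_cong) (use Cons.prems in \<open>auto elim!: list_length_2E simp: order_iso_simps[simplified]\<close>)
  moreover have "distinct (filter ((<) x) p)" using Cons.prems by simp
  ultimately show ?case
    using Cons subseq_sum_increasing_pairs_eq_0_iff[of "filter ((<) x) p"]
    by (simp add: num_occ_eq_subseq_sum subseq_sum_filter numeral_2_eq_2)
qed

text \<open>No entry exceeds \<open>n\<close>, so with this threshold the condition on larger
  entries is vacuous and the rank is \<open>i = 0\<close>.\<close>

lemma Av_123_eq_top_dec: "Av n [1, 2, 3] = top_dec {1..n} n"
proof -
  have "filter ((<) n) p = []" if "set p \<subseteq> {1..n}" for p
    using that by (auto simp: filter_empty_conv)
  then show ?thesis
    unfolding Av_def perms_def avoids_def top_dec_def
    by (auto simp: num_occ_123_eq_0_iff[simplified] permutations_of_set_def)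
qed

lemma card_greater_self: "card {y \<in> {1..n}. n < y} = 0" for n :: nat
proof -
  have "{y \<in> {1..n}. n < y} = {}" by auto
  then show ?thesis by (simp only: card.empty)
qed

lemma total_occ_132: "total_occ [1, 3, 2] (Av n [1, 2, 3]) = ballot_stat (\<lambda>j. j choose 2) n 0"
proof -
  have "sum (num_occ [1, 3, 2]) (top_dec {1..n} n)
      = ballot_stat (\<lambda>j. j choose 2) (card {1..n}) (card {y \<in> {1..n}. n < y})"
  proof (rule sum_stat_top_dec)
    show "num_occ [1, 3, 2] [] = 0" by (simp add: num_occ_eq_subseq_sum)
  qed (use num_occ_132_Cons in auto)
  then show ?thesis
    unfolding total_occ_def Av_123_eq_top_dec card_greater_self by simp
qed

lemma total_occ_12: "total_occ [1, 2] (Av n [1, 2, 3]) = ballot_stat (\<lambda>j. j) n 0"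
proof -
  have "sum (num_occ [1, 2]) (top_dec {1..n} n)
      = ballot_stat (\<lambda>j. j) (card {1..n}) (card {y \<in> {1..n}. n < y})"
  proof (rule sum_stat_top_dec)
    show "num_occ [1, 2] [] = 0" by (simp add: num_occ_eq_subseq_sum)
  qed (use num_occ_12_Cons in auto)
  then show ?thesis
    unfolding total_occ_def Av_123_eq_top_dec card_greater_self by simp
qed

lemma card_Av_123: "card (Av n [1, 2, 3]) = ballot n 0"
  using card_top_dec[of "{1..n}" n] unfolding Av_123_eq_top_dec card_greater_self by simp

section \<open>Linear relations and symmetries between the patterns\<close>

lemma Av_123D:
  assumes "p \<in> Av n [1, 2, 3]"
  shows "distinct p" "set p = {1..n}" "length p = n" "num_occ [1, 2, 3] p = 0"
  using assms by (auto simp: Av_def perms_def avoids_def permutations_of_set_def distinct_card[symmetric])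

lemma num_occ_sum_patterns:
  assumes "distinct p"
  shows "num_occ [1,2,3] p + num_occ [1,3,2] p + num_occ [2,1,3] p + num_occ [2,3,1] p
       + num_occ [3,1,2] p + num_occ [3,2,1] p = length p choose 3"
proof -
  let ?g = "\<lambda>q l. of_bool (order_iso q l) :: nat"
  have "subseq_sum (\<lambda>l. ?g [1,2,3] l + ?g [1,3,2] l + ?g [2,1,3] l + ?g [2,3,1] l + ?g [3,1,2] l + ?g [3,2,1] l) 3 p
      = subseq_sum (\<lambda>_. 1) 3 p"
    by (rule subseq_sum_cong[OF _ assms]) (auto elim!: list_length_3E simp: order_iso_simps[simplified])
  then show ?thesis
    unfolding subseq_sum_add subseq_sum_one num_occ_length_3 .
qed

text \<open>Each pattern is weighted by its number of increasing pairs; 321 has none.\<close>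

lemma num_occ_12_patterns:
  assumes "distinct p"
  shows "3 * num_occ [1,2,3] p + 2 * num_occ [1,3,2] p + 2 * num_occ [2,1,3] p + num_occ [2,3,1] p
       + num_occ [3,1,2] p = (length p - 2) * num_occ [1,2] p"
proof -
  let ?g = "\<lambda>q l. of_bool (order_iso q l) :: nat"
  \<comment> \<open>Weights appear as repeated summands, so that \<open>subseq_sum_add\<close> alone
    splits the sum.\<close>
  have "subseq_sum (\<lambda>l. ?g [1,2,3] l + ?g [1,2,3] l + ?g [1,2,3] l + ?g [1,3,2] l + ?g [1,3,2] l
        + ?g [2,1,3] l + ?g [2,1,3] l + ?g [2,3,1] l + ?g [3,1,2] l) 3 p
      = subseq_sum (\<lambda>l. ?g [1,2] [l ! 0, l ! 1] + ?g [1,2] [l ! 0, l ! 2] + ?g [1,2] [l ! 1, l ! 2]) 3 p"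
    by (rule subseq_sum_cong[OF _ assms]) (auto elim!: list_length_3E simp: order_iso_simps[simplified])
  also have "\<dots> = (length p - 2) * num_occ [1,2] p"
    unfolding num_occ_length_2 by (rule subseq_sum_pairs_in_triples)
  finally show ?thesis
    unfolding subseq_sum_add num_occ_length_3 by simp
qed

text \<open>The complement is always taken in \<open>{1..n}\<close>, because the map is also applied
  to subsequences shorter than \<open>n\<close>.\<close>

definition reverse_complement :: "nat \<Rightarrow> nat list \<Rightarrow> nat list" where
  "reverse_complement n p = rev (map (\<lambda>x. Suc n - x) p)"

text \<open>Reversal and relabelling commute with taking subsequences, so it suffices to compare the
  two patterns on lists of their own length.\<close>

lemma num_occ_reverse_complement:
  assumes "distinct p" "set p \<subseteq> {1..n}" "length q = length q'"
    and "\<And>l. length l = length q \<Longrightarrow> set l \<subseteq> {1..n} \<Longrightarrow> order_iso q (reverse_complement n l) = order_iso q' l"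
  shows "num_occ q (reverse_complement n p) = num_occ q' p"
proof -
  have "num_occ q (reverse_complement n p)
      = subseq_sum (\<lambda>l. of_bool (order_iso q (reverse_complement n l))) (length q) p"
    unfolding num_occ_eq_subseq_sum reverse_complement_def
    by (simp add: subseq_sum_rev subseq_sum_map rev_map)
  also have "\<dots> = subseq_sum (\<lambda>l. of_bool (order_iso q' l)) (length q) p"
    by (rule subseq_sum_cong[OF _ assms(1)]) (use assms(2,4) in auto)
  finally show ?thesis using assms(3) by (simp add: num_occ_eq_subseq_sum)
qed

lemma num_occ_reverse_complement_patterns:
  assumes "distinct p" "set p \<subseteq> {1..n}"
  shows "num_occ [1,2,3] (reverse_complement n p) = num_occ [1,2,3] p"
    and "num_occ [1,3,2] (reverse_complement n p) = num_occ [2,1,3] p"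
    and "num_occ [2,1,3] (reverse_complement n p) = num_occ [1,3,2] p"
    and "num_occ [2,3,1] (reverse_complement n p) = num_occ [3,1,2] p"
    and "num_occ [3,1,2] (reverse_complement n p) = num_occ [2,3,1] p"
  by (rule num_occ_reverse_complement[OF assms];
      auto simp: length_Suc_conv reverse_complement_def order_iso_simps[simplified])+

lemma reverse_complement_Av:
  assumes "p \<in> Av n [1,2,3]"
  shows "reverse_complement n p \<in> Av n [1,2,3]" "reverse_complement n (reverse_complement n p) = p"
proof -
  note p = Av_123D[OF assms]
  have "distinct (reverse_complement n p)"
    using p by (auto simp: reverse_complement_def distinct_map inj_on_def)
  moreover have "(\<lambda>x. Suc n - x) ` {1..n} = {1..n}"
  proof (intro equalityI subsetI)
    fix y assume "y \<in> {1..n}"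
    then have "y = Suc n - (Suc n - y)" "Suc n - y \<in> {1..n}" by auto
    then show "y \<in> (\<lambda>x. Suc n - x) ` {1..n}" by (rule image_eqI)
  qed auto
  then have "set (reverse_complement n p) = {1..n}"
    using p by (simp add: reverse_complement_def)
  ultimately show "reverse_complement n p \<in> Av n [1,2,3]"
    using p num_occ_reverse_complement_patterns(1)[of p n]
    by (simp add: Av_def perms_def avoids_def permutations_of_set_def)
  have "map (\<lambda>x. Suc n - (Suc n - x)) p = p"
    using p by (intro map_idI) auto
  then show "reverse_complement n (reverse_complement n p) = p"
    by (simp add: reverse_complement_def rev_map comp_def)
qed

lemma total_occ_reverse_complement:
  "total_occ [2,1,3] (Av n [1,2,3]) = total_occ [1,3,2] (Av n [1,2,3])"
  "total_occ [3,1,2] (Av n [1,2,3]) = total_occ [2,3,1] (Av n [1,2,3])"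
  unfolding total_occ_def
  by (rule sum.reindex_bij_witness[of _ "reverse_complement n" "reverse_complement n"];
      use reverse_complement_Av Av_123D num_occ_reverse_complement_patterns in \<open>force simp del: One_nat_def\<close>)+

lemma total_occ_pairs:
  "4 * total_occ [1,3,2] (Av n [1,2,3]) + 2 * total_occ [2,3,1] (Av n [1,2,3])
     = (n - 2) * total_occ [1,2] (Av n [1,2,3])"
proof -
  have "(n - 2) * total_occ [1,2] (Av n [1,2,3])
      = (\<Sum>p\<in>Av n [1,2,3]. 2 * num_occ [1,3,2] p + 2 * num_occ [2,1,3] p + num_occ [2,3,1] p + num_occ [3,1,2] p)"
    unfolding total_occ_def sum_distrib_left
  proof (rule sum.cong[OF refl])
    fix p assume "p \<in> Av n [1,2,3]"
    note p = Av_123D[OF this]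
    show "(n - 2) * num_occ [1,2] p
       = 2 * num_occ [1,3,2] p + 2 * num_occ [2,1,3] p + num_occ [2,3,1] p + num_occ [3,1,2] p"
      using num_occ_12_patterns[OF p(1)] p(3,4) by simp
  qed
  also have "\<dots> = 2 * total_occ [1,3,2] (Av n [1,2,3]) + 2 * total_occ [2,1,3] (Av n [1,2,3])
      + total_occ [2,3,1] (Av n [1,2,3]) + total_occ [3,1,2] (Av n [1,2,3])"
    by (simp add: total_occ_def sum.distrib sum_distrib_left)
  finally show ?thesis unfolding total_occ_reverse_complement by simp
qed

lemma total_occ_triples:
  "2 * total_occ [1,3,2] (Av n [1,2,3]) + 2 * total_occ [2,3,1] (Av n [1,2,3])
     + total_occ [3,2,1] (Av n [1,2,3]) = (n choose 3) * card (Av n [1,2,3])"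
proof -
  have "(n choose 3) * card (Av n [1,2,3])
      = (\<Sum>p\<in>Av n [1,2,3]. num_occ [1,3,2] p + num_occ [2,1,3] p + num_occ [2,3,1] p
           + num_occ [3,1,2] p + num_occ [3,2,1] p)"
  proof -
    have "(n choose 3) * card (Av n [1,2,3]) = (\<Sum>p\<in>Av n [1,2,3]. n choose 3)" by simp
    also have "\<dots> = (\<Sum>p\<in>Av n [1,2,3]. num_occ [1,3,2] p + num_occ [2,1,3] p + num_occ [2,3,1] p
           + num_occ [3,1,2] p + num_occ [3,2,1] p)"
    proof (rule sum.cong[OF refl])
      fix p assume "p \<in> Av n [1,2,3]"
      note p = Av_123D[OF this]
      show "n choose 3 = num_occ [1,3,2] p + num_occ [2,1,3] p + num_occ [2,3,1] p
           + num_occ [3,1,2] p + num_occ [3,2,1] p"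
        using num_occ_sum_patterns[OF p(1)] p(3,4) by simp
    qed
    finally show ?thesis .
  qed
  also have "\<dots> = total_occ [1,3,2] (Av n [1,2,3]) + total_occ [2,1,3] (Av n [1,2,3])
      + total_occ [2,3,1] (Av n [1,2,3]) + total_occ [3,1,2] (Av n [1,2,3]) + total_occ [3,2,1] (Av n [1,2,3])"
    by (simp add: total_occ_def sum.distrib)
  finally show ?thesis unfolding total_occ_reverse_complement by simp
qed

section \<open>Closed forms\<close>

text \<open>The binomial coefficients of the theorem are all rational multiples of
  \<open>2 * n choose n\<close>; this and the next lemmas provide the factors with denominators
  cleared.\<close>

lemma choose_odd_Suc:
  "real (Suc n) * real (Suc (2 * n) choose Suc n) = (2 * real n + 1) * real (2 * n choose n)"
  using choose_absorb_real[of n "2 * n"] by (simp add: algebra_simps)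

lemma central_binomial_Suc: "(real n + 1) * real (2 * Suc n choose Suc n) = 2 * (2 * real n + 1) * real (2 * n choose n)"
proof -
  have "real (Suc n) * real (Suc (2 * n) choose Suc n) = (2 * real n + 1) * real (2 * n choose n)"
    by (rule choose_odd_Suc)
  moreover have "Suc (2 * n) choose n = Suc (2 * n) choose Suc n"
    using binomial_symmetric[of n "Suc (2 * n)"] by simp
  then have "real (2 * Suc n choose Suc n) = 2 * real (Suc (2 * n) choose Suc n)"
    by simp
  ultimately show ?thesis by (simp only: of_nat_Suc) (simp add: algebra_simps)
qed

lemma choose_odd_lower:
  assumes "1 \<le> n"
  shows "(real n + 1) * (real n + 2) * real (2 * n + 1 choose (n - 1)) = real n * (2 * real n + 1) * real (2 * n choose n)"
proof -
  obtain m where m: "n = Suc m" using assms by (cases n) auto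
  have "real (Suc n) * real (Suc (2 * n) choose Suc n) = (2 * real n + 1) * real (2 * n choose n)"
    by (rule choose_odd_Suc)
  moreover have "Suc (2 * n) choose n = Suc (2 * n) choose Suc n"
    using binomial_symmetric[of n "Suc (2 * n)"] by simp
  moreover have "real n * real (Suc (2 * n) choose n) = (real n + 2) * real (Suc (2 * n) choose (n - 1))"
    using choose_absorb_real[of m "Suc (2 * n)"] unfolding m by (simp add: algebra_simps)
  ultimately have "(real n + 1) * ((real n + 2) * real (Suc (2 * n) choose (n - 1)))
      = real n * ((2 * real n + 1) * real (2 * n choose n))"
    by (metis (no_types, opaque_lifting) mult.left_commute of_nat_Suc add.commute)
  then show ?thesis by (simp add: mult.assoc)
qed

lemma choose_odd_upper_half:
  assumes "1 \<le> n"
  shows "2 * real (2 * n - 1 choose n) = real (2 * n choose n)"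
    and "2 * real (2 * n - 1 choose (n - 1)) = real (2 * n choose n)"
proof -
  obtain m where m: "n = Suc m" using assms by (cases n) auto
  have "Suc (2 * m) choose m = Suc (2 * m) choose Suc m"
    using binomial_symmetric[of m "Suc (2 * m)"] by simp
  moreover have "2 * n choose n = (Suc (2 * m) choose m) + (Suc (2 * m) choose Suc m)"
    by (simp add: m)
  moreover have "2 * n - 1 = Suc (2 * m)" by (simp add: m)
  ultimately show "2 * real (2 * n - 1 choose n) = real (2 * n choose n)"
    and "2 * real (2 * n - 1 choose (n - 1)) = real (2 * n choose n)"
    by (simp_all add: m)
qed

lemma zchoose_odd_lower:
  assumes "1 \<le> n"
  shows "2 * (real n + 1) * real ((2 * n - 1) zchoose (int n - 2)) = (real n - 1) * real (2 * n choose n)"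
proof (cases "n = 1")
  \<comment> \<open>The lower index is -1 here, so \<open>zchoose\<close> gives 0, matching the
    factor \<open>n - 1\<close>.\<close>
  case True
  then show ?thesis by (simp add: zchoose_def)
next
  case False
  then obtain m where m: "n = Suc (Suc m)" using assms by (metis One_nat_def Suc_le_D old.nat.exhaust)
  have "real (Suc m) * real (2 * n - 1 choose Suc m) = (real (2 * n - 1) - real m) * real (2 * n - 1 choose m)"
    by (rule choose_absorb_real)
  moreover have "(2 * n - 1) zchoose (int n - 2) = (2 * n - 1 choose m)" "Suc m = n - 1"
      "real (2 * n - 1) - real m = real n + 1" "real (Suc m) = real n - 1"
    by (simp_all add: zchoose_def m)
  ultimately have "(real n - 1) * real (2 * n - 1 choose (n - 1)) = (real n + 1) * real ((2 * n - 1) zchoose (int n - 2))"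
    by metis
  then show ?thesis using choose_odd_upper_half(2)[OF assms] by algebra
qed

text \<open>Halving at \<open>n - 1\<close> leads to a central coefficient, which
  \<open>central_binomial_Suc\<close> lifts back to \<open>n\<close>.\<close>

lemma choose_2n_minus_3:
  assumes "2 \<le> n"
  shows "4 * (2 * real n - 1) * real (2 * n - 3 choose (n - 2)) = real n * real (2 * n choose n)"
proof -
  obtain m where m: "n = Suc m" "1 \<le> m" using assms by (cases n) auto
  have "2 * n - 3 = 2 * m - 1" "n - 2 = m - 1" using m by auto
  then have "2 * real (2 * n - 3 choose (n - 2)) = real (2 * m choose m)"
    using choose_odd_upper_half(2)[OF m(2)] by simp
  moreover have "(real m + 1) * real (2 * n choose n) = 2 * (2 * real m + 1) * real (2 * m choose m)"
    unfolding m(1) by (rule central_binomial_Suc)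
  moreover have "4 * (2 * real n - 1) * real (2 * n - 3 choose (n - 2))
      = 2 * (2 * real m + 1) * (2 * real (2 * n - 3 choose (n - 2)))"
    by (simp add: m(1))
  moreover have "real n = real m + 1" by (simp add: m(1))
  ultimately show ?thesis by metis
qed

lemma choose_three_real: "real (n choose 3) = real n * (real n - 1) * (real n - 2) / 6"
proof (induction n)
  case (Suc n)
  have "real (Suc n choose 3) = real (n choose 2) + real (n choose 3)"
    by (simp add: numeral_3_eq_3 numeral_2_eq_2)
  then show ?case unfolding Suc choose_two_real by (simp add: field_simps)
qed simp

theorem corollary24:
  fixes n :: nat
  assumes "n \<ge> 1"
  shows "real (total_occ [1,3,2] (Av n [1,2,3])) =
           (real n + 2) / 4 * real ((2*n) choose n) - 3 * 2 powi (2 * int n - 3)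
       \<and> (n \<ge> 2 \<longrightarrow>
           real (total_occ [2,3,1] (Av n [1,2,3])) =
             (2 * real n - 1) * real ((2*n-3) choose (n-2))
           - (2 * real n + 1) * real ((2*n-1) choose (n-1))
           + (real n + 4) * 2 powi (2 * int n - 3))
       \<and> real (total_occ [3,2,1] (Av n [1,2,3])) =
             1/6 * real ((2*n+5) choose (n+1)) * real ((n+4) choose 2)
           - 5/3 * real ((2*n+3) choose n) * real ((n+3) choose 2)
           + 17/3 * real ((2*n+1) choose (n-1)) * real ((n+2) choose 2)
           - 6 * real ((2*n-1) zchoose (int n - 2)) * real ((n+1) choose 2)
           - (real n + 1) * 4 ^ (n-1)"
proof -
  let ?A = "real (total_occ [1,3,2] (Av n [1,2,3]))"
  let ?B = "real (total_occ [2,3,1] (Av n [1,2,3]))"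
  let ?D = "real (total_occ [3,2,1] (Av n [1,2,3]))"
  define N where "N = real n"
  define c where "c = real (2 * n choose n)"
  define X where "X = (4::real) ^ n"
  define F where "F = real (total_occ [1,2] (Av n [1,2,3]))"
  have N1: "N \<ge> 1" using assms by (simp add: N_def)
  have u: "2 * upper_sum (2 * n) (Suc n) = X - c"
    by (simp add: upper_sum_central X_def c_def)
  have half: "2 * real (2 * n - 1 choose n) = c"
    unfolding c_def by (rule choose_odd_upper_half[OF assms])
  have A: "4 * ?A = (N + 2) * c - 3 / 2 * X"
    using ballot_stat_choose_two_closed[OF assms] u half unfolding total_occ_132 N_def by algebra
  have F: "2 * F = X / 2 - c"
    using ballot_stat_id_closed[OF assms] u half unfolding F_def total_occ_12 by simp
  have AB: "4 * ?A + 2 * ?B = (N - 2) * F"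
  proof (cases "n = 1")
    \<comment> \<open>The truncated \<open>n - 2\<close> is 0 while \<open>N - 2 = -1\<close>; the
      equation survives because \<open>F = 0\<close>.\<close>
    case True
    then have "F = 0" using F by (simp add: X_def c_def)
    then show ?thesis using arg_cong[OF total_occ_pairs[of n], of real] True by simp
  next
    case False
    then have "real (n - 2) = N - 2" using assms by (simp add: N_def)
    then show ?thesis
      using arg_cong[OF total_occ_pairs[of n], of real] unfolding F_def of_nat_add of_nat_mult by simp
  qed
  have B: "2 * ?B = (N - 2) * (X / 4 - c / 2) - (N + 2) * c + 3 / 2 * X"
  proof -
    have "F = X / 4 - c / 2" using F by simp
    then show ?thesis using AB A by simp
  qed
  have cat: "(N + 1) * real (card (Av n [1,2,3])) = c"
  proof -
    have "(N + 1) * real (2 * n choose Suc n) = N * c"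
      using choose_absorb_real[of n "2 * n"] by (simp add: N_def c_def algebra_simps)
    then show ?thesis
      unfolding card_Av_123 ballot_closed[OF le0] by (simp add: c_def algebra_simps)
  qed
  have D: "2 * ?A + 2 * ?B + ?D = N * (N - 1) * (N - 2) / 6 * (c / (N + 1))"
  proof -
    have "real (card (Av n [1,2,3])) = c / (N + 1)" using cat N1 by (simp add: field_simps)
    moreover have "2 * ?A + 2 * ?B + ?D = real (n choose 3) * real (card (Av n [1,2,3]))"
      using arg_cong[OF total_occ_triples[of n], of real] unfolding of_nat_add of_nat_mult by simp
    ultimately show ?thesis by (simp add: choose_three_real N_def)
  qed
  have pow: "2 powi (2 * int n - 3) = X / 8"
  proof -
    have "(2::real) powi (2 * int n - 3) = 2 powi (2 * int n) / 2 powi 3"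
      by (rule power_int_diff) simp
    also have "(2::real) powi (2 * int n) = X"
      using power_int_of_nat[of "2::real" "2 * n"] by (simp add: X_def power_mult)
    finally show ?thesis by simp
  qed
  have pow': "(4::real) ^ (n - 1) = X / 4"
    using assms by (cases n) (simp_all add: X_def)
  \<comment> \<open>At \<open>n = 1\<close> truncation would read the coefficient as
    \<open>0 choose 0 = 1\<close>, and the identity would fail.\<close>
  have b1: "(2 * N - 1) * real ((2*n-3) choose (n-2)) = N * c / 4" if "n \<ge> 2"
    using choose_2n_minus_3[OF that] by (simp add: N_def c_def field_simps)
  have b2: "real ((2*n-1) choose (n-1)) = c / 2"
    using choose_odd_upper_half(2)[OF assms] by (simp add: c_def)
  \<comment> \<open>The coefficients in rows \<open>2 * n + 3\<close> and \<open>2 * n + 5\<close>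
    are reached from the central ones at \<open>n + 1\<close> and \<open>n + 2\<close>.\<close>
  define c1 where "c1 = real (2 * Suc n choose Suc n)"
  define c2 where "c2 = real (2 * Suc (Suc n) choose Suc (Suc n))"
  have c1: "(N + 1) * c1 = 2 * (2 * N + 1) * c"
    using central_binomial_Suc[of n] by (simp only: N_def c_def c1_def)
  have c2: "(N + 2) * c2 = 2 * (2 * N + 3) * c1"
    using central_binomial_Suc[of "Suc n"] by (simp add: N_def c1_def c2_def algebra_simps del: binomial_Suc_Suc)
  have d1: "(N + 1) * (real ((2*n+5) choose (n+1)) * real ((n+4) choose 2)) = 2 * (2 * N + 1) * (2 * N + 3) * (2 * N + 5) * c"
  proof -
    have e: "2 * Suc (Suc n) + 1 = 2 * n + 5" "Suc (Suc n) - 1 = n + 1" "real (Suc (Suc n)) = N + 2"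
      by (auto simp: N_def)
    have "(N + 3) * (N + 4) * real ((2*n+5) choose (n+1)) = (N + 2) * (2 * N + 5) * c2"
      using choose_odd_lower[of "Suc (Suc n)"] unfolding e c2_def[symmetric] by (simp add: add.commute)
    moreover have "2 * real ((n+4) choose 2) = (N + 4) * (N + 3)"
      unfolding choose_two_real by (simp add: N_def)
    ultimately show ?thesis using c1 c2 by algebra
  qed
  have d2: "real ((2*n+3) choose n) * real ((n+3) choose 2) = (2 * N + 1) * (2 * N + 3) * c"
  proof -
    have e: "2 * Suc n + 1 = 2 * n + 3" "Suc n - 1 = n" "real (Suc n) = N + 1"
      by (auto simp: N_def)
    have "(N + 2) * (N + 3) * real ((2*n+3) choose n) = (N + 1) * (2 * N + 3) * c1"
      using choose_odd_lower[of "Suc n"] unfolding e c1_def[symmetric] by (simp add: add.commute)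
    moreover have "2 * real ((n+3) choose 2) = (N + 3) * (N + 2)"
      unfolding choose_two_real by (simp add: N_def)
    ultimately show ?thesis using c1 by algebra
  qed
  have d3: "real ((2*n+1) choose (n-1)) * real ((n+2) choose 2) = N * (2 * N + 1) * c / 2"
    using choose_odd_lower[OF assms] unfolding choose_two_real by (simp add: N_def c_def algebra_simps)
  have d4: "real ((2*n-1) zchoose (int n - 2)) * real ((n+1) choose 2) = N * (N - 1) * c / 4"
  proof -
    have "2 * (N + 1) * real ((2*n-1) zchoose (int n - 2)) = (N - 1) * c"
      using zchoose_odd_lower[OF assms] by (simp add: N_def c_def)
    moreover have "2 * real ((n+1) choose 2) = (N + 1) * N"
      unfolding choose_two_real by (simp add: N_def)
    ultimately show ?thesis by algebra
  qed
  have rA: "?A = (N + 2) / 4 * c - 3 * (X / 8)" using A by (simp add: field_simps)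
  have rB: "?B = N * c / 4 - (2 * N + 1) * (c / 2) + (N + 4) * (X / 8)" using B by (simp add: field_simps)
  have rD: "?D = 1/6 * (real ((2*n+5) choose (n+1)) * real ((n+4) choose 2))
           - 5/3 * ((2 * N + 1) * (2 * N + 3) * c) + 17/3 * (N * (2 * N + 1) * c / 2)
           - 6 * (N * (N - 1) * c / 4) - (N + 1) * (X / 4)"
  proof -
    \<comment> \<open>\<open>k\<close> is the Catalan number. Writing \<open>c = k * (N + 1)\<close>
      absorbs the denominator and leaves a polynomial identity in \<open>N\<close>, \<open>k\<close>
      and \<open>X\<close>.\<close>
    define k where "k = c / (N + 1)"
    have c: "c = k * (N + 1)" using N1 by (simp add: k_def)
    have "real ((2*n+5) choose (n+1)) * real ((n+4) choose 2) = 2 * (2 * N + 1) * (2 * N + 3) * (2 * N + 5) * k"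
      using d1 N1 unfolding k_def by (simp add: field_simps)
    moreover have "?D = N * (N - 1) * (N - 2) / 6 * k - 2 * ?A - 2 * ?B"
      using D by (simp add: k_def)
    ultimately show ?thesis
      unfolding rA rB c by (simp add: field_simps)
  qed
  have "?D = 1/6 * real ((2*n+5) choose (n+1)) * real ((n+4) choose 2)
           - 5/3 * real ((2*n+3) choose n) * real ((n+3) choose 2)
           + 17/3 * real ((2*n+1) choose (n-1)) * real ((n+2) choose 2)
           - 6 * real ((2*n-1) zchoose (int n - 2)) * real ((n+1) choose 2)
           - (real n + 1) * 4 ^ (n-1)"
    unfolding mult.assoc d2 d3 d4 pow' using rD by (simp add: N_def mult.assoc)
  moreover have "?A = (real n + 2) / 4 * real ((2*n) choose n) - 3 * 2 powi (2 * int n - 3)"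
    unfolding pow using rA by (simp add: N_def c_def)
  moreover have "?B = (2 * real n - 1) * real ((2*n-3) choose (n-2))
           - (2 * real n + 1) * real ((2*n-1) choose (n-1))
           + (real n + 4) * 2 powi (2 * int n - 3)" if "n \<ge> 2"
    unfolding pow b2 using rB b1[OF that] by (simp add: N_def)
  ultimately show ?thesis by blast
qed

end
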